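(* Let $\{\varphi_i\}_{i=1}^\kappa$ be an iterated function system consisting of similitudes of $\mathbb{R}$, and let $E$ be its self-similar set. Suppose that $E \subset [0,1]$, that $E$ is Furstenberg homogeneous, and that $\dim_{\mathrm H}(E) < 1$. Then $E$ satisfies the uniform weak separation condition, i.e. the iterated function system $\{\varphi_i\}_{i=1}^\kappa$ satisfies the uniform weak separation condition.
   Context: Iterated function system of similitudes on $\mathbb{R}$: a finite collection $\{\varphi_i\}_{i=1}^\kappa$, $\kappa \ge 2$, of maps $\varphi_i \colon \mathbb{R} \to \mathbb{R}$ with $|\varphi_i(x)-\varphi_i(y)| = r_i|x-y|$ for all $x,y$, where $0<r_i<1$, such that at least two of the maps have distinct fixed points. Its self-similar set $E$ is the unique non-empty compact set with $E = \bigcup_{i=1}^\kappa \varphi_i(E)$. $\dim_{\mathrm H}$ denotes Hausdorff dimension. Words: $\Sigma_*$ is the set of all finite words (including the empty word $\varnothing$) over $\{1,\ldots,\kappa\}$; for a non-empty word $\mathtt{i}$, $\mathtt{i}^-$ is $\mathtt{i}$ with its last letter removed. For $\mathtt{i}=i_1\cdots i_n$ write $\varphi_{\mathtt{i}} = \varphi_{i_1}\circ\cdots\circ\varphi_{i_n}$, and $\varphi_\varnothing = \mathrm{id}$. Uniform weak separation condition: let $W \subset \mathbb{R}$ be a closed and bounded set of positive diameter with $\varphi_i(W)\subset W$ for all $i$ (such a set exists; then $\{\varphi_{\mathtt{i}}(W) : \mathtt{i}\in\Sigma_*\}$ is the Moran construction associated to the iterated function system). For $r>0$ let $\Sigma(r)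 = \{\mathtt{i}\in\Sigma_*\setminus\{\varnothing\} : \operatorname{diam}(\varphi_{\mathtt{i}}(W)) \le r < \operatorname{diam}(\varphi_{\mathtt{i}^-}(W))\}$, $\Phi(r) = \{\varphi_{\mathtt{i}} : \mathtt{i}\in\Sigma(r)\}$ (a set of maps, so coinciding maps are counted once), and $\Phi(x,r) = \{\varphi\in\Phi(r) : \varphi(W)\cap B(x,r)\ne\emptyset\}$, where $B(x,r)$ is the closed ball. The system satisfies the uniform weak separation condition if $\sup_{x\in E}\sup_{r>0}\#\Phi(x,r)<\infty$. Furstenberg homogeneity (in $\mathbb{R}$, with $Q=[0,1]$): a set $A'\subset Q$ is a Furstenberg miniset of $A\subset Q$ if $A' \subset (\lambda A+t)\cap Q$ for some $\lambda\ge 1$ and $t\in\mathbb{R}$, where $\lambda A + t = \{\lambda x+t : x\in A\}$. A set $A'\subset Q$ is a Furstenberg microset of a compact set $A\subset Q$ if there is a sequence $(A_n')_{n\ge1}$ of Furstenberg minisets of $A$ with $A_n'\to A'$ in the Hausdorff metric. A set $A\subset Q$ is Furstenberg homogeneous if every Furstenberg microset of $A$ is a Furstenberg miniset of $A$. *)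

theory Defs
  imports "HOL-Analysis.Analysis"
begin

section \<open>Hausdorff dimension\<close>

text \<open>
  The summand \<open>(diam U)^s\<close>, with the usual conventions \<open>0\<^sup>0 = 1\<close> for non-empty \<open>U\<close>
  and value \<open>0\<close> for \<open>U = {}\<close>. (In the library, \<open>0 powr 0 = 0\<close>.)
\<close>
definition hausdorff_gauge :: "real \<Rightarrow> 'a::metric_space set \<Rightarrow> ennreal" where
  "hausdorff_gauge s U =
     (if U = {} then 0 else if s = 0 then 1 else ennreal (diameter U powr s))"

text \<open>
  Covers consist of bounded sets only, since \<open>diameter\<close> carries no information on unbounded sets.
\<close>
definition delta_covers :: "real \<Rightarrow> 'a::metric_space set \<Rightarrow> (nat \<Rightarrow> 'a set) set" where
  "delta_covers \<delta> A =
     {U. A \<subseteq> (\<Union>n. U n) \<and> (\<forall>n. bounded (U n) \<and> diameter (U n) \<le> \<delta>)}"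

definition hausdorff_premeasure :: "real \<Rightarrow> real \<Rightarrow> 'a::metric_space set \<Rightarrow> ennreal" where
  "hausdorff_premeasure s \<delta> A = (INF U\<in>delta_covers \<delta> A. \<Sum>n. hausdorff_gauge s (U n))"

definition hausdorff_measure :: "real \<Rightarrow> 'a::metric_space set \<Rightarrow> ennreal" where
  "hausdorff_measure s A = (SUP \<delta>\<in>{0<..}. hausdorff_premeasure s \<delta> A)"

definition hausdorff_dim :: "'a::metric_space set \<Rightarrow> ereal" where
  "hausdorff_dim A = (INF s\<in>{s. 0 \<le> s \<and> hausdorff_measure s A = 0}. ereal s)"


section \<open>Iterated function systems of similitudes on the real line\<close>

definition similitude_ifs :: "nat \<Rightarrow> (nat \<Rightarrow> real \<Rightarrow> real) \<Rightarrow> bool" where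
  "similitude_ifs \<kappa> \<phi> \<longleftrightarrow>
     2 \<le> \<kappa> \<and>
     (\<forall>i\<in>{1..\<kappa>}. \<exists>r. 0 < r \<and> r < 1 \<and> (\<forall>x y. \<bar>\<phi> i x - \<phi> i y\<bar> = r * \<bar>x - y\<bar>)) \<and>
     (\<exists>i\<in>{1..\<kappa>}. \<exists>j\<in>{1..\<kappa>}. \<exists>x y. \<phi> i x = x \<and> \<phi> j y = y \<and> x \<noteq> y)"

text \<open>For an iterated function system these conditions hold for exactly one set \<open>E\<close>.\<close>
definition is_self_similar_set :: "nat \<Rightarrow> (nat \<Rightarrow> real \<Rightarrow> real) \<Rightarrow> real set \<Rightarrow> bool" where
  "is_self_similar_set \<kappa> \<phi> E \<longleftrightarrow> E \<noteq> {} \<and> compact E \<and> E = (\<Union>i\<in>{1..\<kappa>}. \<phi> i ` E)"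


section \<open>The uniform weak separation condition\<close>

primrec word_map :: "(nat \<Rightarrow> real \<Rightarrow> real) \<Rightarrow> nat list \<Rightarrow> real \<Rightarrow> real" where
  "word_map \<phi> [] = id"
| "word_map \<phi> (i # w) = \<phi> i \<circ> word_map \<phi> w"

definition moran_base :: "nat \<Rightarrow> (nat \<Rightarrow> real \<Rightarrow> real) \<Rightarrow> real set \<Rightarrow> bool" where
  "moran_base \<kappa> \<phi> W \<longleftrightarrow>
     closed W \<and> bounded W \<and> 0 < diameter W \<and> (\<forall>i\<in>{1..\<kappa>}. \<phi> i ` W \<subseteq> W)"

definition words_at_scale ::
    "nat \<Rightarrow> (nat \<Rightarrow> real \<Rightarrow> real) \<Rightarrow> real set \<Rightarrow> real \<Rightarrow> nat list set" where
  "words_at_scale \<kappa> \<phi> W r =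
     {w \<in> lists {1..\<kappa>}. w \<noteq> [] \<and>
        diameter (word_map \<phi> w ` W) \<le> r \<and> r < diameter (word_map \<phi> (butlast w) ` W)}"

definition maps_at_scale ::
    "nat \<Rightarrow> (nat \<Rightarrow> real \<Rightarrow> real) \<Rightarrow> real set \<Rightarrow> real \<Rightarrow> (real \<Rightarrow> real) set" where
  "maps_at_scale \<kappa> \<phi> W r = word_map \<phi> ` words_at_scale \<kappa> \<phi> W r"

definition maps_near ::
    "nat \<Rightarrow> (nat \<Rightarrow> real \<Rightarrow> real) \<Rightarrow> real set \<Rightarrow> real \<Rightarrow> real \<Rightarrow> (real \<Rightarrow> real) set" where
  "maps_near \<kappa> \<phi> W x r = {f \<in> maps_at_scale \<kappa> \<phi> W r. f ` W \<inter> cball x r \<noteq> {}}"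

definition uniform_weak_separation ::
    "nat \<Rightarrow> (nat \<Rightarrow> real \<Rightarrow> real) \<Rightarrow> real set \<Rightarrow> real set \<Rightarrow> bool" where
  "uniform_weak_separation \<kappa> \<phi> W E \<longleftrightarrow>
     (\<exists>N. \<forall>x\<in>E. \<forall>r>0. finite (maps_near \<kappa> \<phi> W x r) \<and> card (maps_near \<kappa> \<phi> W x r) \<le> N)"


section \<open>Furstenberg homogeneity\<close>

text \<open>A metric on the non-empty compact sets; only used for those.\<close>
definition hausdorff_distance :: "'a::metric_space set \<Rightarrow> 'a set \<Rightarrow> real" where
  "hausdorff_distance A B = max (SUP a\<in>A. infdist a B) (SUP b\<in>B. infdist b A)"

definition furstenberg_miniset :: "real set \<Rightarrow> real set \<Rightarrow> bool" where
  "furstenberg_miniset A' A \<longleftrightarrow>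
     A' \<subseteq> {0..1} \<and> (\<exists>l t. 1 \<le> l \<and> A' \<subseteq> (\<lambda>x. l * x + t) ` A \<inter> {0..1})"

text \<open>
  The Hausdorff metric lives on the non-empty compact subsets of \<open>{0..1}\<close>, so the limit and the
  members of the approximating sequence are taken to be such sets.
\<close>
definition furstenberg_microset :: "real set \<Rightarrow> real set \<Rightarrow> bool" where
  "furstenberg_microset A' A \<longleftrightarrow>
     A' \<subseteq> {0..1} \<and> A' \<noteq> {} \<and> compact A' \<and>
     (\<exists>M :: nat \<Rightarrow> real set.
        (\<forall>n. furstenberg_miniset (M n) A \<and> M n \<noteq> {} \<and> compact (M n)) \<and>
        (\<lambda>n. hausdorff_distance (M n) A') \<longlonglongrightarrow> 0)"

definition furstenberg_homogeneous :: "real set \<Rightarrow> bool" where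
  "furstenberg_homogeneous A \<longleftrightarrow>
     A \<subseteq> {0..1} \<and> (\<forall>A'. furstenberg_microset A' A \<longrightarrow> furstenberg_miniset A' A)"

end

theory Submission
  imports Defs
begin

text \<open>
  The proof goes by contradiction: if the uniform weak separation condition fails, then \<open>[0,1]\<close> is a
  Furstenberg microset of \<open>E\<close>. By homogeneity \<open>[0,1]\<close> is then a miniset, so \<open>E\<close> contains an
  interval, and its Hausdorff dimension is at least 1
  (\<open>interval_imp_hausdorff_dim_ge_1\<close>).

  The failure of separation enters through pairs of word maps \<open>f \<noteq> g\<close> for which the affine map
  \<open>h = g\<^sup>-\<^sup>1 \<circ> f\<close> is arbitrarily close to the identity. They come from the pigeonhole principle
  (\<open>near_identity_pairs_exist\<close>): rescaled to scale 1 at \<open>x\<close>, the maps that are near \<open>x\<close> at scale \<open>r\<close>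
  have their coefficients in a compact set that depends on neither \<open>x\<close> nor \<open>r\<close>, so if there are
  many of them, then two are close together.

  Such a pair makes \<open>E\<close> denser (\<open>nearly_fills_step\<close>). Let \<open>E\<close> be \<open>\<eta> |I|\<close>-dense in an interval \<open>I\<close>.
  A power of one of the maps of the system carries \<open>I\<close> to an interval \<open>J\<close> so small that its length is
  comparable to the displacement of \<open>h\<close> on \<open>J\<close>. Then \<open>J \<union> h(J)\<close> is an interval that is longer than
  \<open>J\<close> by a constant factor. Its image under \<open>g\<close> is \<open>g(J) \<union> f(J)\<close>, where \<open>E\<close> is about as dense,
  in absolute terms, as it is in each of the two parts, because \<open>f\<close> and \<open>g\<close> map \<open>E\<close> into itself.
  Hence the relative density constant \<open>\<eta>\<close> improves by a fixed factor less than 1, and iteration makes it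
  arbitrarily small. Blowing up the corresponding intervals to \<open>[0,1]\<close> gives minisets of \<open>E\<close> that
  converge to \<open>[0,1]\<close> (\<open>unit_interval_microset\<close>).
\<close>

section \<open>Affine maps of the line\<close>

definition slope :: "(real \<Rightarrow> real) \<Rightarrow> real" where
  "slope f = f 1 - f 0"

definition affine_bij :: "(real \<Rightarrow> real) \<Rightarrow> bool" where
  "affine_bij f \<longleftrightarrow> slope f \<noteq> 0 \<and> (\<forall>x. f x = slope f * x + f 0)"

lemma affine_bijI:
  assumes "\<And>x. f x = c * x + d" "c \<noteq> 0"
  shows "affine_bij f" "slope f = c"
proof -
  show "slope f = c"
    by (simp add: slope_def assms(1))
  then show "affine_bij f"
    using assms by (auto simp: affine_bij_def)
qed

lemma affine_bij_apply: "affine_bij f \<Longrightarrow> f x = slope f * x + f 0"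
  unfolding affine_bij_def by blast

lemma affine_bij_slope: "affine_bij f \<Longrightarrow> slope f \<noteq> 0"
  unfolding affine_bij_def by blast

lemma affine_bij_diff:
  assumes "affine_bij f"
  shows "f x - f y = slope f * (x - y)"
  using affine_bij_apply[OF assms, of x] affine_bij_apply[OF assms, of y]
  by (simp add: algebra_simps)

lemma affine_bij_comp:
  assumes "affine_bij f" "affine_bij g"
  shows "affine_bij (f \<circ> g)" "slope (f \<circ> g) = slope f * slope g"
proof -
  have *: "(f \<circ> g) x = (slope f * slope g) * x + f (g 0)" for x
    using affine_bij_apply[OF assms(1), of "g x"] affine_bij_apply[OF assms(1), of "g 0"]
      affine_bij_apply[OF assms(2), of x]
    by (simp add: algebra_simps)
  have "slope f * slope g \<noteq> 0"
    using assms by (simp add: affine_bij_slope)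
  with * show "affine_bij (f \<circ> g)" "slope (f \<circ> g) = slope f * slope g"
    using affine_bijI[of "f \<circ> g"] by blast+
qed

text \<open>
  The sign of \<open>f x - f 0 = \<plusminus> r x\<close> cannot change with \<open>x\<close>: comparing the distances to \<open>f 1\<close> shows
  that a point \<open>x\<close> with the wrong sign is equally far from \<open>1\<close> and \<open>-1\<close>, that is, \<open>x = 0\<close>.
\<close>
lemma similitude_affine_bij:
  fixes f :: "real \<Rightarrow> real"
  assumes r: "0 < r" and sim: "\<And>x y. \<bar>f x - f y\<bar> = r * \<bar>x - y\<bar>"
  shows "affine_bij f" "\<bar>slope f\<bar> = r"
proof -
  show sl: "\<bar>slope f\<bar> = r"
    using sim[of 1 0] by (simp add: slope_def)
  have "f x = slope f * x + f 0" for x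
  proof -
    have "\<bar>f x - f 0\<bar> = \<bar>slope f * x\<bar>"
      using sim[of x 0] sl by (simp add: abs_mult)
    then consider "f x - f 0 = slope f * x" | "f x - f 0 = - (slope f * x)"
      by linarith
    then show ?thesis
    proof cases
      case 2
      have "f x - f 1 = - (slope f * (x + 1))"
        using 2 by (simp add: slope_def algebra_simps)
      then have "r * \<bar>x + 1\<bar> = r * \<bar>x - 1\<bar>"
        using sim[of x 1] sl by (simp add: abs_mult)
      then have "x = 0"
        using r by auto
      then show ?thesis by simp
    qed simp
  qed
  then show "affine_bij f"
    unfolding affine_bij_def using sl r by fastforce
qed

lemma affine_bij_image_interval:
  assumes "affine_bij f" "u \<le> v"
  obtains u' v' where "f ` {u..v} = {u'..v'}" "v' - u' = \<bar>slope f\<bar> * (v - u)"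
    "{u', v'} = {f u, f v}"
proof -
  have image_affine: "f ` {u..v} = (\<lambda>x. slope f * x + f 0) ` {u..v}"
    by (rule image_cong[OF refl affine_bij_apply[OF assms(1)]])
  show ?thesis
  proof (cases "0 < slope f")
    case True
    have "f ` {u..v} = {f u..f v}"
      using True assms(2)
      unfolding image_affine affine_bij_apply[OF assms(1), of u] affine_bij_apply[OF assms(1), of v]
      by (simp add: image_affinity_atLeastAtMost)
    then show ?thesis
      using True affine_bij_diff[OF assms(1), of v u] by (intro that[of "f u" "f v"]) auto
  next
    case False
    have "f ` {u..v} = {f v..f u}"
      using False assms(2)
      unfolding image_affine affine_bij_apply[OF assms(1), of u] affine_bij_apply[OF assms(1), of v]
      by (simp add: image_affinity_atLeastAtMost)
    then show ?thesis
      using False affine_bij_diff[OF assms(1), of u v]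
      by (intro that[of "f v" "f u"]) (auto simp: algebra_simps)
  qed
qed

lemma diameter_affine_image:
  assumes f: "affine_bij f" and W: "bounded W"
  shows "diameter (f ` W) = \<bar>slope f\<bar> * diameter W"
proof (cases "W = {}")
  case False
  have c: "0 < \<bar>slope f\<bar>"
    using affine_bij_slope[OF f] by simp
  have dist: "dist (f x) (f y) = \<bar>slope f\<bar> * dist x y" for x y
    using affine_bij_diff[OF f] by (simp add: dist_real_def abs_mult)
  have le: "diameter (f ` W) \<le> \<bar>slope f\<bar> * diameter W"
    using False dist c diameter_bounded_bound[OF W]
    by (intro diameter_le) (auto simp: dist_norm)
  have bdd: "bounded (f ` W)"
  proof -
    have "f ` W = (\<lambda>x. f 0 + x) ` ((\<lambda>x. slope f *\<^sub>R x) ` W)"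
      unfolding image_image
      by (intro image_cong refl, subst affine_bij_apply[OF f]) (simp add: add.commute)
    then show ?thesis
      by (simp only: bounded_translation bounded_scaling W)
  qed
  have "diameter W \<le> diameter (f ` W) / \<bar>slope f\<bar>"
  proof (rule diameter_le)
    fix x y assume "x \<in> W" "y \<in> W"
    then have "\<bar>slope f\<bar> * dist x y \<le> diameter (f ` W)"
      unfolding dist[symmetric] by (intro diameter_bounded_bound[OF bdd]) auto
    then show "norm (x - y) \<le> diameter (f ` W) / \<bar>slope f\<bar>"
      using c by (simp add: dist_norm field_simps)
  qed (use False in simp)
  with le c show ?thesis
    by (simp add: field_simps)
qed simp

section \<open>Relative density in an interval\<close>

definition dense_up_to :: "real \<Rightarrow> real set \<Rightarrow> real set \<Rightarrow> bool" where
  "dense_up_to d E I \<longleftrightarrow> (\<forall>y\<in>I. \<exists>e\<in>E. \<bar>y - e\<bar> \<le> d)"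

text \<open>
  The error is measured relative to the length of the interval, so that the notion is invariant
  under rescaling.
\<close>
definition nearly_fills :: "real \<Rightarrow> real set \<Rightarrow> bool" where
  "nearly_fills \<eta> E \<longleftrightarrow> (\<exists>u v. u < v \<and> dense_up_to (\<eta> * (v - u)) E {u..v})"

lemma dense_up_to_image:
  assumes "dense_up_to d E I" "affine_bij f" "f ` E \<subseteq> E"
  shows "dense_up_to (\<bar>slope f\<bar> * d) E (f ` I)"
  unfolding dense_up_to_def
proof
  fix y assume "y \<in> f ` I"
  then obtain x where x: "x \<in> I" "y = f x" by blast
  then obtain e where e: "e \<in> E" "\<bar>x - e\<bar> \<le> d"
    using assms(1) by (auto simp: dense_up_to_def)
  have "\<bar>y - f e\<bar> = \<bar>slope f\<bar> * \<bar>x - e\<bar>"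
    using affine_bij_diff[OF assms(2), of x e] x by (simp add: abs_mult)
  then show "\<exists>e\<in>E. \<bar>y - e\<bar> \<le> \<bar>slope f\<bar> * d"
    using e assms(3) by (intro bexI[of _ "f e"]) (auto intro: mult_left_mono)
qed

lemma dense_up_to_mono:
  "dense_up_to d E I \<Longrightarrow> d \<le> d' \<Longrightarrow> dense_up_to d' E I"
  unfolding dense_up_to_def by (meson order_trans)

lemma dense_up_to_Un:
  "dense_up_to d E I \<Longrightarrow> dense_up_to d E J \<Longrightarrow> dense_up_to d E (I \<union> J)"
  by (auto simp: dense_up_to_def)

lemma power_within_factor:
  fixes s \<tau> :: real
  assumes "0 < s" "s < 1" "0 < \<tau>" "\<tau> \<le> 1"
  obtains n where "\<tau> \<le> s ^ n" "s * s ^ n \<le> \<tau>"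
proof -
  obtain N where N: "s ^ N < \<tau>"
    using real_arch_pow_inv[OF assms(3,2)] by blast
  define n where "n = (LEAST n. s ^ n < \<tau>)"
  have n: "s ^ n < \<tau>"
    unfolding n_def by (rule LeastI[of "\<lambda>n. s ^ n < \<tau>", OF N])
  then have "n \<noteq> 0"
    using assms by (auto intro: gr0I)
  then obtain k where k: "n = Suc k"
    using not0_implies_Suc by blast
  have "\<not> s ^ k < \<tau>"
    using not_less_Least[of k "\<lambda>n. s ^ n < \<tau>"] k n_def by simp
  then show ?thesis
    using that[of k] n k by simp
qed

text \<open>
  The map \<open>x \<mapsto> a x + b\<close> moves both endpoints of \<open>[u,v]\<close> in the direction of \<open>t\<close>, by at least \<open>|t|/2\<close>
  and at most \<open>3|t|/2\<close>. The lower bound makes the union longer; the upper bound, together with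
  \<open>3|t|/2 \<le> v - u\<close>, keeps the image in contact with \<open>[u,v]\<close>.
\<close>
lemma displaced_interval_grows:
  fixes a b :: real
  assumes J: "u < v" and a: "0 < a"
    and disp: "\<And>x. x \<in> {u, v} \<Longrightarrow> \<bar>((a - 1) * x + b) - t\<bar> \<le> \<bar>t\<bar> / 2"
    and t: "t \<noteq> 0" "3 / 2 * \<bar>t\<bar> \<le> v - u"
  obtains u' v' where "{u..v} \<union> (\<lambda>x. a * x + b) ` {u..v} = {u'..v'}"
    "v' - u' \<ge> (v - u) + \<bar>t\<bar> / 2"
proof -
  have im: "(\<lambda>x. a * x + b) ` {u..v} = {a * u + b..a * v + b}"
    using J a by (simp add: image_affinity_atLeastAtMost)
  have u: "\<bar>(a * u + b) - u - t\<bar> \<le> \<bar>t\<bar> / 2" and v: "\<bar>(a * v + b) - v - t\<bar> \<le> \<bar>t\<bar> / 2"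
    using disp[of u] disp[of v] by (simp_all add: algebra_simps)
  show ?thesis
  proof (cases "t > 0")
    case True
    have "{u..v} \<union> {a * u + b..a * v + b} = {u..a * v + b}"
      using True u v t J by (auto simp: abs_if split: if_splits)
    then show ?thesis
      using that[of u "a * v + b"] im v True by (auto simp: abs_if split: if_splits)
  next
    case False
    have "{u..v} \<union> {a * u + b..a * v + b} = {a * u + b..v}"
      using False u v t J by (auto simp: abs_if split: if_splits)
    then show ?thesis
      using that[of "a * u + b" v] im u False t by (auto simp: abs_if split: if_splits)
  qed
qed

text \<open>
  The point \<open>p\<close> is the fixed point of a contraction \<open>S\<close> that preserves \<open>E\<close>, and \<open>m\<close> is the displacement
  of \<open>h x = a x + b\<close> at \<open>p\<close>. The bound \<open>|a - 1| K \<le> 2 m\<close> says that the displacement changes by at most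
  \<open>m/2\<close> within distance \<open>K/4\<close> of \<open>p\<close>. The power \<open>S\<^sup>n\<close> is chosen so that the image of \<open>[u,v]\<close> has
  length between \<open>3m/2\<close> and \<open>3m/(2\<rho>)\<close>; the smallness of \<open>m\<close> then places this image within distance
  \<open>K/4\<close> of \<open>p\<close>. Up to a scaling common to both, the length then grows by a factor of at least
  \<open>1 + \<rho>/3\<close>, while the absolute error grows by a factor of at most \<open>1 + \<rho>/6\<close>.
\<close>
lemma nearly_fills_step:
  fixes a b p \<sigma> \<rho> K C :: real
  assumes S: "\<And>x. S x = p + \<sigma> * (x - p)" "S ` E \<subseteq> E"
    and \<sigma>: "0 < \<rho>" "\<rho> \<le> \<bar>\<sigma>\<bar>" "\<bar>\<sigma>\<bar> < 1"
    and f: "affine_bij f" "f ` E \<subseteq> E" and g: "affine_bij g" "g ` E \<subseteq> E"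
    and fg: "\<And>x. f x = g (a * x + b)" and a: "0 < a" "a \<le> 1 + \<rho> / 6"
    and m: "m = \<bar>(a - 1) * p + b\<bar>" "0 < m" and K: "\<bar>a - 1\<bar> * K \<le> 2 * m"
    and uv: "u < v" "dense_up_to (\<eta> * (v - u)) E {u..v}" "0 \<le> \<eta>"
    and small: "3 / 2 * m \<le> v - u" "6 * m * C \<le> \<rho> * (v - u) * K"
    and C: "\<bar>u - p\<bar> \<le> C" "\<bar>v - p\<bar> \<le> C"
  shows "nearly_fills ((1 + \<rho> / 6) / (1 + \<rho> / 3) * \<eta>) E"
proof -
  define L where "L = v - u"
  have L: "L > 0" using uv by (simp add: L_def)
  have \<sigma>0: "0 < \<bar>\<sigma>\<bar>" using \<sigma> by simp
  obtain n where n: "3 / 2 * m / L \<le> \<bar>\<sigma>\<bar> ^ n" "\<bar>\<sigma>\<bar> * \<bar>\<sigma>\<bar> ^ n \<le> 3 / 2 * m / L"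
    using power_within_factor[of "\<bar>\<sigma>\<bar>" "3 / 2 * m / L"] \<sigma> \<sigma>0 L m small by (auto simp: L_def)
  define l where "l = \<bar>\<sigma>\<bar> ^ n * L"
  have l_lo: "3 / 2 * m \<le> l"
    using n(1) L by (simp add: l_def field_simps)
  have \<rho>n: "\<rho> * \<bar>\<sigma>\<bar> ^ n \<le> 3 / 2 * m / L"
    using n(2) \<sigma> by (meson abs_ge_zero mult_right_mono order_trans zero_le_power)
  have l_hi: "\<rho> * l \<le> 3 / 2 * m"
    using \<rho>n L by (simp add: l_def field_simps)
  have l_pos: "l > 0" using l_lo m(2) by linarith
  define T where "T = S ^^ n"
  have T: "T x = p + \<sigma> ^ n * (x - p)" for x
    unfolding T_def by (induction n) (simp_all add: S(1))
  have "\<sigma> ^ n \<noteq> 0" using \<sigma>0 by simp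
  then have T_aff: "affine_bij T" "slope T = \<sigma> ^ n"
    using affine_bijI[of T "\<sigma> ^ n" "p - \<sigma> ^ n * p"] T by (auto simp: algebra_simps)
  have T_E: "T ` E \<subseteq> E"
    unfolding T_def using S(2) by (induction n) auto
  obtain u' v' where J: "T ` {u..v} = {u'..v'}" "v' - u' = \<bar>slope T\<bar> * (v - u)" "{u', v'} = {T u, T v}"
    using affine_bij_image_interval[OF T_aff(1), of u v] uv(1) by auto
  have Jl: "v' - u' = l"
    using J(2) T_aff by (simp add: l_def L_def power_abs)
  have dJ: "dense_up_to (\<eta> * l) E {u'..v'}"
    using dense_up_to_image[OF uv(2) T_aff(1) T_E] J(1) T_aff(2)
    by (simp add: l_def L_def power_abs mult_ac)
  define t where "t = (a - 1) * p + b"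
  have near: "\<bar>x - p\<bar> \<le> K / 4" if "x \<in> {u', v'}" for x
  proof -
    have "\<bar>x - p\<bar> \<le> \<bar>\<sigma>\<bar> ^ n * C"
      using that C unfolding J(3) by (auto simp: T abs_mult power_abs intro!: mult_left_mono)
    moreover have "\<bar>\<sigma>\<bar> ^ n * C \<le> K / 4"
    proof -
      have "0 \<le> C" using C by linarith
      then have "\<rho> * \<bar>\<sigma>\<bar> ^ n * C \<le> 3 / 2 * m / L * C"
        using \<rho>n by (intro mult_right_mono)
      also have "\<dots> \<le> \<rho> * (K / 4)"
        using small(2) L by (simp add: L_def field_simps)
      finally show ?thesis
        using \<sigma>(1) by (simp add: mult.assoc)
    qed
    ultimately show ?thesis by linarith
  qed
  have disp: "\<bar>((a - 1) * x + b) - t\<bar> \<le> \<bar>t\<bar> / 2" if "x \<in> {u', v'}" for x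
  proof -
    have "\<bar>((a - 1) * x + b) - t\<bar> = \<bar>a - 1\<bar> * \<bar>x - p\<bar>"
      by (simp add: t_def abs_mult[symmetric] algebra_simps)
    also have "\<dots> \<le> \<bar>a - 1\<bar> * (K / 4)"
      using near[OF that] by (intro mult_left_mono) auto
    also have "\<dots> = \<bar>a - 1\<bar> * K / 4" by simp
    also have "\<dots> \<le> 2 * m / 4"
      using K by (intro divide_right_mono) auto
    also have "\<dots> = \<bar>t\<bar> / 2"
      by (simp add: m(1) t_def)
    finally show ?thesis .
  qed
  obtain x y where U: "{u'..v'} \<union> (\<lambda>x. a * x + b) ` {u'..v'} = {x..y}"
    "y - x \<ge> (v' - u') + \<bar>t\<bar> / 2"
    using displaced_interval_grows[of u' v' a b t] disp l_lo Jl l_pos a m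
    by (auto simp: t_def)
  have yx: "y - x \<ge> (1 + \<rho> / 3) * l"
    using U(2) Jl l_hi m by (simp add: t_def algebra_simps)
  then have "x < y"
    using l_pos \<sigma>(1) by (smt (verit) mult_pos_pos divide_pos_pos)
  have slope_f: "slope f = slope g * a"
    using affine_bij_diff[OF g(1), of "a * 1 + b" "a * 0 + b"] fg by (simp add: slope_def)
  have "f ` {u'..v'} = g ` (\<lambda>x. a * x + b) ` {u'..v'}"
    by (simp add: image_image fg)
  then have gxy: "g ` {x..y} = g ` {u'..v'} \<union> f ` {u'..v'}"
    unfolding U(1)[symmetric] image_Un by simp
  have g0: "0 < \<bar>slope g\<bar>" using affine_bij_slope[OF g(1)] by simp
  have le1: "\<bar>slope g\<bar> * (\<eta> * l) \<le> \<bar>slope g\<bar> * ((1 + \<rho> / 6) * (\<eta> * l))"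
    using uv l_pos \<sigma> by (intro mult_left_mono) (auto simp: algebra_simps)
  have le2: "\<bar>slope f\<bar> * (\<eta> * l) \<le> \<bar>slope g\<bar> * ((1 + \<rho> / 6) * (\<eta> * l))"
    unfolding slope_f abs_mult mult.assoc using a uv l_pos
    by (intro mult_left_mono mult_right_mono) auto
  have dU: "dense_up_to (\<bar>slope g\<bar> * ((1 + \<rho> / 6) * (\<eta> * l))) E (g ` {x..y})"
    unfolding gxy
    by (intro dense_up_to_Un dense_up_to_mono[OF dense_up_to_image[OF dJ g] le1]
        dense_up_to_mono[OF dense_up_to_image[OF dJ f] le2])
  obtain x' y' where gI: "g ` {x..y} = {x'..y'}" "y' - x' = \<bar>slope g\<bar> * (y - x)" "{x', y'} = {g x, g y}"
    by (rule affine_bij_image_interval[OF g(1) less_imp_le[OF \<open>x < y\<close>]])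
  have "x' < y'"
    using gI(2) g0 \<open>x < y\<close> by (smt (verit) mult_pos_pos)
  moreover have "\<bar>slope g\<bar> * ((1 + \<rho> / 6) * (\<eta> * l))
      \<le> (1 + \<rho> / 6) / (1 + \<rho> / 3) * \<eta> * (y' - x')"
  proof -
    have "(1 + \<rho> / 6) / (1 + \<rho> / 3) * \<eta> * (\<bar>slope g\<bar> * ((1 + \<rho> / 3) * l))
        \<le> (1 + \<rho> / 6) / (1 + \<rho> / 3) * \<eta> * (\<bar>slope g\<bar> * (y - x))"
      using yx uv \<sigma> by (intro mult_left_mono) auto
    moreover have "(1 + \<rho> / 6) / (1 + \<rho> / 3) * \<eta> * (\<bar>slope g\<bar> * ((1 + \<rho> / 3) * l))
       = \<bar>slope g\<bar> * ((1 + \<rho> / 6) * (\<eta> * l))"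
      using \<sigma>(1) by (simp add: field_simps)
    ultimately show ?thesis by (simp add: gI(2))
  qed
  ultimately show ?thesis
    unfolding nearly_fills_def using dense_up_to_mono[OF dU] gI(1) by auto
qed

text \<open>
  Two different fixed points are needed because \<open>h\<close> may fix one of them. An affine displacement
  \<open>\<delta> \<noteq> 0\<close> cannot vanish at both \<open>p\<close> and \<open>q\<close>, and at the one where \<open>|\<delta>|\<close> is larger it controls the
  slope of \<open>\<delta>\<close>: \<open>|a - 1| |p - q| = |\<delta> p - \<delta> q| \<le> 2 |\<delta>|\<close>.
\<close>
lemma nearly_fills_improve:
  fixes p q :: real
  assumes S: "affine_bij S" "S p = p" "S ` E \<subseteq> E" "\<rho> \<le> \<bar>slope S\<bar>" "\<bar>slope S\<bar> < 1"
    and T: "affine_bij T" "T q = q" "T ` E \<subseteq> E" "\<rho> \<le> \<bar>slope T\<bar>" "\<bar>slope T\<bar> < 1"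
    and pq: "p \<noteq> q" and \<rho>: "0 < \<rho>"
    and pairs: "\<And>\<epsilon>. 0 < \<epsilon> \<Longrightarrow> \<exists>f g a b. affine_bij f \<and> f ` E \<subseteq> E \<and> affine_bij g \<and> g ` E \<subseteq> E \<and>
        f \<noteq> g \<and> (\<forall>x. f x = g (a * x + b)) \<and> \<bar>a - 1\<bar> \<le> \<epsilon> \<and> \<bar>b\<bar> \<le> \<epsilon>"
    and fills: "nearly_fills \<eta> E"
  shows "nearly_fills ((1 + \<rho> / 6) / (1 + \<rho> / 3) * \<eta>) E"
proof -
  obtain u v where uv: "u < v" "dense_up_to (\<eta> * (v - u)) E {u..v}"
    using fills by (auto simp: nearly_fills_def)
  obtain e where "\<bar>u - e\<bar> \<le> \<eta> * (v - u)"
    using uv by (auto simp: dense_up_to_def dest!: bspec[of _ _ u])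
  then have "0 \<le> \<eta> * (v - u)" by linarith
  then have \<eta>: "0 \<le> \<eta>" using uv(1) by (simp add: zero_le_mult_iff)
  define K where "K = \<bar>p - q\<bar>"
  have K: "K > 0" using pq by (simp add: K_def)
  define C where "C = \<bar>u - p\<bar> + \<bar>v - p\<bar> + \<bar>u - q\<bar> + \<bar>v - q\<bar> + 1"
  have C: "C > 0" by (simp add: C_def)
  define D where "D = \<bar>p\<bar> + \<bar>q\<bar> + 1"
  have D: "D > 0" by (simp add: D_def)
  \<comment> \<open>The displacement at \<open>p\<close> and \<open>q\<close> will be at most \<open>\<epsilon> D \<le> M\<close>, small enough for the step to apply.\<close>
  define M where "M = min (2 / 3 * (v - u)) (\<rho> * (v - u) * K / (6 * C))"
  have M: "M > 0" using uv \<rho> K C by (simp add: M_def)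
  define \<epsilon> where "\<epsilon> = min (min (1 / 2) (\<rho> / 6)) (M / D)"
  have \<epsilon>: "\<epsilon> > 0" using M D \<rho> by (simp add: \<epsilon>_def)
  obtain f g a b where f: "affine_bij f" "f ` E \<subseteq> E" and g: "affine_bij g" "g ` E \<subseteq> E"
    and "f \<noteq> g" and fg: "\<And>x. f x = g (a * x + b)" and ab: "\<bar>a - 1\<bar> \<le> \<epsilon>" "\<bar>b\<bar> \<le> \<epsilon>"
    using pairs[OF \<epsilon>] by metis
  have "\<bar>a - 1\<bar> \<le> 1 / 2" "\<bar>a - 1\<bar> \<le> \<rho> / 6"
    using ab(1) by (simp_all add: \<epsilon>_def)
  then have a: "0 < a" "a \<le> 1 + \<rho> / 6" by linarith+
  define \<delta> where "\<delta> x = (a - 1) * x + b" for x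
  have \<delta>_diff: "\<bar>a - 1\<bar> * K = \<bar>\<delta> p - \<delta> q\<bar>"
    by (simp add: \<delta>_def K_def abs_mult[symmetric] algebra_simps)
  have \<delta>_small: "\<bar>\<delta> x\<bar> \<le> M" if "\<bar>x\<bar> + 1 \<le> D" for x
  proof -
    have "\<bar>\<delta> x\<bar> \<le> \<bar>a - 1\<bar> * \<bar>x\<bar> + \<bar>b\<bar>"
      unfolding \<delta>_def by (metis abs_mult abs_triangle_ineq)
    also have "\<dots> \<le> \<epsilon> * \<bar>x\<bar> + \<epsilon>"
      using ab by (intro add_mono mult_right_mono) auto
    also have "\<dots> \<le> \<epsilon> * D"
      using that \<epsilon> by (metis distrib_left mult.right_neutral mult_left_mono less_imp_le)
    also have "\<dots> \<le> M / D * D"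
      using D by (intro mult_right_mono) (simp_all add: \<epsilon>_def)
    finally show ?thesis using D by simp
  qed
  have "\<not> (\<delta> p = 0 \<and> \<delta> q = 0)"
  proof
    assume *: "\<delta> p = 0 \<and> \<delta> q = 0"
    then have "a = 1" using \<delta>_diff K by simp
    moreover have "b = 0" using * \<open>a = 1\<close> by (simp add: \<delta>_def)
    ultimately have "f = g" using fg by auto
    with \<open>f \<noteq> g\<close> show False by simp
  qed
  have step: "nearly_fills ((1 + \<rho> / 6) / (1 + \<rho> / 3) * \<eta>) E"
    if R: "affine_bij R" "R z = z" "R ` E \<subseteq> E" "\<rho> \<le> \<bar>slope R\<bar>" "\<bar>slope R\<bar> < 1"
      and z: "z = p \<or> z = q" "\<delta> z \<noteq> 0" "\<bar>a - 1\<bar> * K \<le> 2 * \<bar>\<delta> z\<bar>" for R z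
  proof (rule nearly_fills_step[where S = R and p = z and K = K and C = C and f = f and g = g
        and a = a and b = b and \<sigma> = "slope R" and m = "\<bar>\<delta> z\<bar>" and u = u and v = v])
    show "R x = z + slope R * (x - z)" for x
      using affine_bij_diff[OF R(1), of x z] R(2) by simp
    have "\<bar>\<delta> z\<bar> \<le> M"
      using z(1) by (intro \<delta>_small) (auto simp: D_def)
    then have le: "\<bar>\<delta> z\<bar> \<le> 2 / 3 * (v - u)" "\<bar>\<delta> z\<bar> \<le> \<rho> * (v - u) * K / (6 * C)"
      by (simp_all add: M_def)
    show "3 / 2 * \<bar>\<delta> z\<bar> \<le> v - u" using le(1) by simp
    show "6 * \<bar>\<delta> z\<bar> * C \<le> \<rho> * (v - u) * K"
      using le(2) C by (simp add: field_simps)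
    show "\<bar>u - z\<bar> \<le> C" "\<bar>v - z\<bar> \<le> C"
      using z(1) by (auto simp: C_def)
    show "\<bar>\<delta> z\<bar> = \<bar>(a - 1) * z + b\<bar>" by (simp add: \<delta>_def)
    show "0 < \<bar>\<delta> z\<bar>" using z(2) by simp
  qed (fact R f g fg a uv \<eta> \<rho> z)+
  show ?thesis
  proof (cases "\<bar>\<delta> q\<bar> \<le> \<bar>\<delta> p\<bar>")
    case True
    then show ?thesis
      using step[of S p] S \<delta>_diff \<open>\<not> (\<delta> p = 0 \<and> \<delta> q = 0)\<close> by auto
  next
    case False
    then show ?thesis
      using step[of T q] T \<delta>_diff by auto
  qed
qed

lemma nearly_fills_iterate:
  assumes "nearly_fills 1 E" "0 \<le> c" "c < 1" "0 < \<epsilon>"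
    and step: "\<And>\<eta>. nearly_fills \<eta> E \<Longrightarrow> nearly_fills (c * \<eta>) E"
  shows "nearly_fills \<epsilon> E"
proof -
  obtain n where n: "c ^ n < \<epsilon>"
    using real_arch_pow_inv[OF assms(4,3)] by blast
  have "nearly_fills (c ^ n) E"
    using assms(1) by (induction n) (auto dest: step)
  then obtain u v where "u < v" "dense_up_to (c ^ n * (v - u)) E {u..v}"
    by (auto simp: nearly_fills_def)
  then show ?thesis
    unfolding nearly_fills_def using n
    by (meson dense_up_to_mono diff_gt_0_iff_gt less_imp_le mult_right_mono)
qed

section \<open>The unit interval as a microset\<close>

text \<open>
  A nearly filled interval \<open>[u,v]\<close> may be slightly longer than 1, but its length is at most 2. So its
  left half, rather than all of it, is blown up to \<open>[0,1]\<close>: this guarantees a magnification of at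
  least 1.
\<close>
lemma unit_interval_microset:
  assumes E: "E \<subseteq> {0..1}" "compact E" and fills: "\<And>\<epsilon>. 0 < \<epsilon> \<Longrightarrow> nearly_fills \<epsilon> E"
  shows "furstenberg_microset {0..1} E"
proof -
  have approx: "\<exists>M. furstenberg_miniset M E \<and> M \<noteq> {} \<and> compact M \<and> hausdorff_distance M {0..1} \<le> 4 * \<epsilon>"
    if \<epsilon>: "0 < \<epsilon>" "\<epsilon> \<le> 1 / 4" for \<epsilon>
  proof -
    obtain u v where uv: "u < v" "dense_up_to (\<epsilon> * (v - u)) E {u..v}"
      using fills[OF \<epsilon>(1)] by (auto simp: nearly_fills_def)
    obtain e1 e2 where "e1 \<in> E" "e2 \<in> E" and e: "\<bar>u - e1\<bar> \<le> \<epsilon> * (v - u)" "\<bar>v - e2\<bar> \<le> \<epsilon> * (v - u)"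
      using uv unfolding dense_up_to_def by (meson atLeastAtMost_iff less_imp_le order_refl)
    have "e1 \<in> {0..1}" "e2 \<in> {0..1}"
      using \<open>e1 \<in> E\<close> \<open>e2 \<in> E\<close> E(1) by blast+
    then have "\<bar>e1 - e2\<bar> \<le> 1"
      by auto
    moreover have "\<epsilon> * (v - u) \<le> 1 / 4 * (v - u)"
      using \<epsilon> uv by (intro mult_right_mono) auto
    ultimately have len: "v - u \<le> 2"
      using abs_le_D1[OF e(2)] abs_le_D2[OF e(1)] by (simp add: abs_le_iff)
    define l where "l = 2 / (v - u)"
    have l: "1 \<le> l" "0 < l" using len uv by (simp_all add: l_def)
    define M where "M = (\<lambda>x. l * x + (- l * u)) ` E \<inter> {0..1}"
    have dense: "\<exists>z\<in>M. \<bar>y - z\<bar> \<le> 4 * \<epsilon>" if y: "y \<in> {0..1}" for y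
    proof -
      \<comment> \<open>Points near 0 and 1 are first moved inwards, so that the point of the blow-up found near them
        lies in the unit interval.\<close>
      define y' where "y' = max (2 * \<epsilon>) (min y (1 - 2 * \<epsilon>))"
      have y': "2 * \<epsilon> \<le> y'" "y' \<le> 1 - 2 * \<epsilon>" "\<bar>y - y'\<bar> \<le> 2 * \<epsilon>"
        using y \<epsilon> by (auto simp: y'_def)
      have "0 \<le> y' / l"
        using y' \<epsilon> l by simp
      moreover have "y' / l \<le> v - u"
      proof -
        have "y' * (v - u) \<le> 2 * (v - u)"
          using y' \<epsilon> uv by (intro mult_right_mono) auto
        then have "y' * (v - u) / 2 \<le> v - u" by simp
        then show ?thesis by (simp add: l_def)
      qed
      ultimately have "u + y' / l \<in> {u..v}"
        by simp
      then obtain x where x: "x \<in> E" "\<bar>u + y' / l - x\<bar> \<le> \<epsilon> * (v - u)"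
        using uv(2) unfolding dense_up_to_def by blast
      have "\<bar>y' - (l * x + (- l * u))\<bar> = l * \<bar>u + y' / l - x\<bar>"
      proof -
        have "y' - (l * x + (- l * u)) = l * (u + y' / l - x)"
          using l by (simp add: field_simps)
        then show ?thesis using l by (simp add: abs_mult)
      qed
      also have "\<dots> \<le> l * (\<epsilon> * (v - u))"
        using x l by (intro mult_left_mono) auto
      also have "\<dots> = 2 * \<epsilon>"
        using uv by (simp add: l_def)
      finally have d: "\<bar>y' - (l * x + (- l * u))\<bar> \<le> 2 * \<epsilon>" .
      then have "l * x + (- l * u) \<in> {0..1}"
        using y' by auto
      then have "l * x + (- l * u) \<in> M"
        using x by (auto simp: M_def)
      moreover have "\<bar>y - (l * x + (- l * u))\<bar> \<le> 4 * \<epsilon>"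
        using d y' by linarith
      ultimately show ?thesis by blast
    qed
    have M: "M \<subseteq> {0..1}" by (auto simp: M_def)
    have "M \<noteq> {}" using dense[of 0] by auto
    have "compact M"
      unfolding M_def using E(2)
      by (intro compact_Int compact_continuous_image continuous_intros) auto
    moreover have "furstenberg_miniset M E"
      unfolding furstenberg_miniset_def M_def using l by blast
    moreover have "hausdorff_distance M {0..1} \<le> 4 * \<epsilon>"
      unfolding hausdorff_distance_def
    proof (intro max.boundedI cSUP_least)
      fix z assume "z \<in> M"
      then show "infdist z {0..1} \<le> 4 * \<epsilon>"
        using M \<epsilon> by (simp add: subset_iff)
    next
      fix y :: real assume "y \<in> {0..1}"
      then obtain z where "z \<in> M" "\<bar>y - z\<bar> \<le> 4 * \<epsilon>"
        using dense by blast
      then show "infdist y M \<le> 4 * \<epsilon>"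
        using infdist_le2[of z M y] by (simp add: dist_real_def)
    qed (use \<open>M \<noteq> {}\<close> in auto)
    ultimately show ?thesis
      using \<open>M \<noteq> {}\<close> by blast
  qed
  have "\<exists>M. furstenberg_miniset M E \<and> M \<noteq> {} \<and> compact M \<and>
      hausdorff_distance M {0..1} \<le> 4 * (1 / (real n + 4))" for n :: nat
    by (rule approx) (simp_all add: field_simps)
  then obtain M where M: "\<And>n::nat. furstenberg_miniset (M n) E \<and> M n \<noteq> {} \<and> compact (M n) \<and>
      hausdorff_distance (M n) {0..1} \<le> 4 * (1 / (real n + 4))"
    by metis
  have nonneg: "0 \<le> hausdorff_distance (M n) {0..1}" for n
  proof -
    have sub: "M n \<subseteq> {0..1}"
      using M[of n] by (auto simp: furstenberg_miniset_def)
    have "(SUP a\<in>M n. infdist a {0..1}) = (SUP a\<in>M n. 0)"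
      using sub by (intro SUP_cong) auto
    also have "\<dots> = 0"
      using M[of n] by simp
    finally show ?thesis
      by (simp add: hausdorff_distance_def)
  qed
  have "(\<lambda>n. 4 * (1 / (real n + 4))) \<longlonglongrightarrow> 0"
    using tendsto_mult_right_zero[OF LIMSEQ_ignore_initial_segment[OF lim_1_over_n, of 4], of 4] by simp
  then have "(\<lambda>n. hausdorff_distance (M n) {0..1}) \<longlonglongrightarrow> 0"
    by (rule tendsto_sandwich[OF _ _ tendsto_const, rotated 2]) (use M nonneg in auto)
  then show ?thesis
    unfolding furstenberg_microset_def using M by auto
qed

section \<open>Hausdorff dimension of sets containing an interval\<close>

text \<open>
  For \<open>s < 1\<close> and sets of diameter at most 1, the gauge \<open>(diam U)\<^sup>s\<close> dominates \<open>diam U\<close>, which is the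
  Lebesgue measure of the smallest closed interval containing \<open>U\<close>. Hence the \<open>s\<close>-dimensional premeasure
  of an interval is at least its length.
\<close>
lemma interval_imp_hausdorff_dim_ge_1:
  fixes E :: "real set"
  assumes "{c..d} \<subseteq> E" "c < d"
  shows "1 \<le> hausdorff_dim E"
proof (rule ccontr)
  assume "\<not> 1 \<le> hausdorff_dim E"
  then obtain s where s: "0 \<le> s" "s < 1" "hausdorff_measure s E = 0"
    by (auto simp: hausdorff_dim_def INF_less_iff not_le one_ereal_def)
  have "hausdorff_premeasure s 1 E \<le> hausdorff_measure s E"
    unfolding hausdorff_measure_def by (rule SUP_upper) simp
  then have "hausdorff_premeasure s 1 E < ennreal (d - c)"
    using s assms by simp
  then obtain U where U: "U \<in> delta_covers 1 E" "(\<Sum>n. hausdorff_gauge s (U n)) < ennreal (d - c)"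
    by (auto simp: hausdorff_premeasure_def INF_less_iff)
  define I where "I n = (if U n = {} then {} else {Inf (U n)..Sup (U n)})" for n
  have UI: "U n \<subseteq> I n \<and> emeasure lborel (I n) \<le> hausdorff_gauge s (U n)" for n
  proof (cases "U n = {}")
    case False
    have b: "bounded (U n)" "diameter (U n) \<le> 1"
      using U(1) by (auto simp: delta_covers_def)
    have "U n \<subseteq> I n"
      using b False by (auto simp: I_def bounded_imp_bdd_above bounded_imp_bdd_below
          intro!: cInf_lower cSup_upper)
    have dle: "x - y \<le> diameter (U n)" if "x \<in> U n" "y \<in> U n" for x y
      using diameter_bounded_bound[OF b(1) that] by (simp add: dist_real_def)
    have "Sup (U n) \<le> y + diameter (U n)" if "y \<in> U n" for y
      using False dle[OF _ that] by (intro cSup_least) (auto simp: algebra_simps)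
    then have "Sup (U n) - diameter (U n) \<le> Inf (U n)"
      using False by (intro cInf_greatest) (auto simp: algebra_simps)
    then have len: "Sup (U n) - Inf (U n) \<le> diameter (U n)" by simp
    have "Inf (U n) \<le> Sup (U n)"
      using b False by (meson bounded_imp_bdd_above bounded_imp_bdd_below cInf_le_cSup)
    then have "emeasure lborel (I n) = ennreal (Sup (U n) - Inf (U n))"
      using False by (simp add: I_def)
    also have "\<dots> \<le> ennreal (diameter (U n))"
      using len by (rule ennreal_leI)
    also have "\<dots> \<le> hausdorff_gauge s (U n)"
    proof (cases "s = 0")
      case True
      then show ?thesis
        using b False by (simp add: hausdorff_gauge_def)
    next
      case s0: False
      have "0 \<le> diameter (U n)" using b by (simp add: diameter_ge_0)
      then have "diameter (U n) \<le> diameter (U n) powr s"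
        using powr_mono'[of s 1 "diameter (U n)"] s b by (cases "diameter (U n) = 0") auto
      then show ?thesis
        using False s0 by (simp add: hausdorff_gauge_def ennreal_leI)
    qed
    finally show ?thesis using \<open>U n \<subseteq> I n\<close> by simp
  qed (simp add: I_def)
  have I_sets: "I n \<in> sets lborel" for n by (simp add: I_def)
  have "{c..d} \<subseteq> (\<Union>n. I n)"
  proof
    fix x assume "x \<in> {c..d}"
    then have "x \<in> (\<Union>n. U n)"
      using assms(1) U(1) unfolding delta_covers_def by blast
    then show "x \<in> (\<Union>n. I n)"
      using UI by blast
  qed
  then have "emeasure lborel {c..d} \<le> emeasure lborel (\<Union>n. I n)"
    using I_sets by (intro emeasure_mono) auto
  also have "\<dots> \<le> (\<Sum>n. emeasure lborel (I n))"
    using I_sets by (intro emeasure_subadditive_countably) auto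
  also have "\<dots> \<le> (\<Sum>n. hausdorff_gauge s (U n))"
    using UI by (intro suminf_le) auto
  also note U(2)
  finally show False
    using assms(2) by simp
qed

section \<open>Word maps close to each other when separation fails\<close>

lemma word_map_append: "word_map \<phi> (u @ w) = word_map \<phi> u \<circ> word_map \<phi> w"
  by (induction u) (simp_all add: comp_assoc)

lemma word_map_affine_bij:
  assumes "\<And>i. i \<in> A \<Longrightarrow> affine_bij (\<phi> i)" "w \<in> lists A"
  shows "affine_bij (word_map \<phi> w)"
  using assms(2)
proof (induction w)
  case Nil
  show ?case by (simp add: affine_bij_def slope_def)
next
  case (Cons i w)
  then show ?case
    unfolding word_map.simps using assms(1) by (intro affine_bij_comp(1)) auto
qed

lemma word_map_image_subset:
  assumes "\<And>i. i \<in> A \<Longrightarrow> \<phi> i ` E \<subseteq> E" "w \<in> lists A"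
  shows "word_map \<phi> w ` E \<subseteq> E"
  using assms(2)
proof (induction w)
  case (Cons i w)
  then show ?case
    using assms(1)[of i] by fastforce
qed simp

text \<open>
  After division by \<open>r\<close> the slope of \<open>f\<close> and the offset of \<open>f 0\<close> from \<open>x\<close> are bounded independently of
  \<open>x\<close> and \<open>r\<close>. The lower bound on the slope is what turns closeness of \<open>f\<close> and \<open>g\<close> relative to \<open>r\<close>
  into closeness of \<open>g\<^sup>-\<^sup>1 \<circ> f\<close> to the identity.
\<close>
lemma maps_near_normalised:
  assumes aff: "\<And>i. i \<in> {1..\<kappa>} \<Longrightarrow> affine_bij (\<phi> i)"
    and \<rho>: "\<And>i. i \<in> {1..\<kappa>} \<Longrightarrow> \<rho> \<le> \<bar>slope (\<phi> i)\<bar>"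
    and W: "bounded W" "0 < diameter W" "\<And>z. z \<in> W \<Longrightarrow> \<bar>z\<bar> \<le> B"
    and r: "0 < r" and f: "f \<in> maps_near \<kappa> \<phi> W x r"
  shows "\<rho> * r / diameter W \<le> \<bar>slope f\<bar>" "\<bar>slope f\<bar> \<le> r / diameter W"
    "\<bar>f 0 - x\<bar> \<le> r * (1 + B / diameter W)"
    "\<exists>w\<in>lists {1..\<kappa>}. f = word_map \<phi> w"
proof -
  obtain w where w: "w \<in> lists {1..\<kappa>}" "w \<noteq> []" "f = word_map \<phi> w"
    "diameter (word_map \<phi> w ` W) \<le> r" "r < diameter (word_map \<phi> (butlast w) ` W)"
    and hit: "f ` W \<inter> cball x r \<noteq> {}"
    using f by (auto simp: maps_near_def maps_at_scale_def words_at_scale_def)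
  show "\<exists>w\<in>lists {1..\<kappa>}. f = word_map \<phi> w" using w by blast
  have w_eq: "w = butlast w @ [last w]" using w(2) by simp
  have bl: "butlast w \<in> lists {1..\<kappa>}" "last w \<in> {1..\<kappa>}"
    using w(1,2) by (auto simp: in_lists_conv_set dest: in_set_butlastD)
  have affw: "affine_bij f" "affine_bij (word_map \<phi> (butlast w))"
    using word_map_affine_bij[of "{1..\<kappa>}" \<phi>, OF aff] w bl by auto
  show up: "\<bar>slope f\<bar> \<le> r / diameter W"
    using w(3,4) W affw by (simp add: diameter_affine_image field_simps)
  have "f = word_map \<phi> (butlast w) \<circ> \<phi> (last w)"
    using w(3) by (subst (asm) w_eq) (simp only: word_map_append word_map.simps comp_id)
  then have sl: "\<bar>slope f\<bar> = \<bar>slope (word_map \<phi> (butlast w))\<bar> * \<bar>slope (\<phi> (last w))\<bar>"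
    using affine_bij_comp(2)[OF affw(2) aff[OF bl(2)]] by (simp add: abs_mult)
  have "r / diameter W \<le> \<bar>slope (word_map \<phi> (butlast w))\<bar>"
    using w(5) W affw by (simp add: diameter_affine_image field_simps)
  then have "\<bar>slope (\<phi> (last w))\<bar> * (r / diameter W) \<le> \<bar>slope f\<bar>"
    unfolding sl by (subst mult.commute) (intro mult_right_mono, auto)
  moreover have "\<rho> * (r / diameter W) \<le> \<bar>slope (\<phi> (last w))\<bar> * (r / diameter W)"
    using \<rho>[OF bl(2)] r W by (intro mult_right_mono) auto
  ultimately show "\<rho> * r / diameter W \<le> \<bar>slope f\<bar>" by simp
  obtain z where z: "z \<in> W" "\<bar>x - f z\<bar> \<le> r"
    using hit by (auto simp: dist_real_def)
  have "\<bar>f 0 - x\<bar> \<le> \<bar>x - f z\<bar> + \<bar>slope f\<bar> * \<bar>z\<bar>"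
    using affine_bij_diff[OF affw(1), of 0 z] by (simp add: abs_mult[symmetric])
  also have "\<dots> \<le> r + r / diameter W * B"
    using z W up r by (intro add_mono mult_mono) auto
  finally show "\<bar>f 0 - x\<bar> \<le> r * (1 + B / diameter W)"
    by (simp add: algebra_simps)
qed

lemma near_identity_pair:
  assumes f: "affine_bij f" and g: "affine_bij g" and "0 < r" "0 < c"
    and c: "c * r \<le> \<bar>slope g\<bar>"
    and d: "\<bar>slope f / r - slope g / r\<bar> \<le> \<epsilon> * c" "\<bar>(f 0 - x) / r - (g 0 - x) / r\<bar> \<le> \<epsilon> * c"
  shows "\<exists>a b. (\<forall>x. f x = g (a * x + b)) \<and> \<bar>a - 1\<bar> \<le> \<epsilon> \<and> \<bar>b\<bar> \<le> \<epsilon>"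
proof -
  have g0: "slope g \<noteq> 0" by (rule affine_bij_slope[OF g])
  have eq: "f y = g (slope f / slope g * y + (f 0 - g 0) / slope g)" for y
    unfolding affine_bij_apply[OF f, of y]
      affine_bij_apply[OF g, of "slope f / slope g * y + (f 0 - g 0) / slope g"]
    using g0 by (simp add: field_simps)
  have \<epsilon>: "0 \<le> \<epsilon>"
  proof -
    have "0 \<le> \<epsilon> * c" by (rule order_trans[OF abs_ge_zero d(1)])
    with \<open>0 < c\<close> show ?thesis by (simp add: zero_le_mult_iff)
  qed
  have key: "\<bar>t / slope g\<bar> \<le> \<epsilon>" if "\<bar>t / r\<bar> \<le> \<epsilon> * c" for t
  proof -
    have "\<bar>t\<bar> \<le> \<epsilon> * (c * r)"
      using that \<open>0 < r\<close> by (simp add: field_simps)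
    also have "\<dots> \<le> \<epsilon> * \<bar>slope g\<bar>"
      using c \<epsilon> by (intro mult_left_mono)
    finally show ?thesis
      using g0 by (simp add: field_simps)
  qed
  have "\<bar>slope f / slope g - 1\<bar> \<le> \<epsilon>"
    using key[of "slope f - slope g"] d(1) g0 by (simp add: diff_divide_distrib)
  moreover have "\<bar>(f 0 - g 0) / slope g\<bar> \<le> \<epsilon>"
    using key[of "f 0 - g 0"] d(2) by (simp add: diff_divide_distrib)
  ultimately show ?thesis
    using eq by blast
qed

text \<open>
  A finite net of the compact parameter set, of a mesh that depends on neither \<open>x\<close> nor \<open>r\<close>, bounds the number of
  maps near any point at any scale as long as no two of them are near the same point of the net; two
  maps that are form a pair as required.
\<close>
lemma near_identity_pairs_exist:
  assumes aff: "\<And>i. i \<in> {1..\<kappa>} \<Longrightarrow> affine_bij (\<phi> i)"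
    and \<rho>: "0 < \<rho>" "\<And>i. i \<in> {1..\<kappa>} \<Longrightarrow> \<rho> \<le> \<bar>slope (\<phi> i)\<bar>"
    and W: "bounded W" "0 < diameter W"
    and not_wsc: "\<not> uniform_weak_separation \<kappa> \<phi> W E" and \<epsilon>: "0 < \<epsilon>"
  shows "\<exists>f g a b. f \<in> word_map \<phi> ` lists {1..\<kappa>} \<and> g \<in> word_map \<phi> ` lists {1..\<kappa>} \<and> f \<noteq> g \<and>
    (\<forall>x. f x = g (a * x + b)) \<and> \<bar>a - 1\<bar> \<le> \<epsilon> \<and> \<bar>b\<bar> \<le> \<epsilon>"
proof (rule ccontr)
  assume none: "\<not> ?thesis"
  obtain B where B: "\<And>z. z \<in> W \<Longrightarrow> \<bar>z\<bar> \<le> B"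
    using W(1) by (auto simp: bounded_iff)
  define D where "D = diameter W"
  define box where "box = {- (1 / D)..1 / D} \<times> {- (1 + B / D)..1 + B / D}"
  define \<epsilon>' where "\<epsilon>' = \<epsilon> * (\<rho> / D) / 2"
  have D: "0 < D" using W by (simp add: D_def)
  then have \<epsilon>': "0 < \<epsilon>'" using \<epsilon> \<rho> by (simp add: \<epsilon>'_def)
  have "compact box"
    unfolding box_def by (intro compact_Times compact_Icc)
  then obtain F where F: "finite F" "box \<subseteq> (\<Union>y\<in>F. ball y \<epsilon>')"
    using compact_eq_totally_bounded \<epsilon>' by metis
  have "finite (maps_near \<kappa> \<phi> W x r) \<and> card (maps_near \<kappa> \<phi> W x r) \<le> card F" if r: "0 < r" for x r
  proof -
    define N where "N = maps_near \<kappa> \<phi> W x r"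
    define nf where "nf f = (slope f / r, (f 0 - x) / r)" for f
    note norm = maps_near_normalised[of \<kappa> \<phi> \<rho> W B r _ x, OF aff \<rho>(2) W B r, folded D_def N_def]
    have "nf f \<in> box" if "f \<in> N" for f
    proof -
      have "\<bar>slope f / r\<bar> \<le> 1 / D"
        using norm(2)[OF _ _ _ that] r D by (simp add: field_simps)
      moreover have "\<bar>(f 0 - x) / r\<bar> \<le> 1 + B / D"
        using norm(3)[OF _ _ _ that] r by (simp add: field_simps)
      ultimately show ?thesis
        unfolding nf_def box_def mem_Times_iff fst_conv snd_conv atLeastAtMost_iff by linarith
    qed
    then have "\<exists>y\<in>F. dist y (nf f) < \<epsilon>'" if "f \<in> N" for f
      using F(2) that by (fastforce simp: subset_iff)
    then obtain y where y: "\<And>f. f \<in> N \<Longrightarrow> y f \<in> F \<and> dist (y f) (nf f) < \<epsilon>'"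
      by metis
    have "inj_on y N"
    proof (rule inj_onI, rule ccontr)
      fix f g assume fg: "f \<in> N" "g \<in> N" "y f = y g" "f \<noteq> g"
      have "dist (nf f) (nf g) \<le> dist (y f) (nf f) + dist (y f) (nf g)"
        by (metis dist_commute dist_triangle)
      also have "\<dots> \<le> \<epsilon> * (\<rho> / D)"
        using y[OF fg(1)] y[OF fg(2)] fg(3) by (simp add: \<epsilon>'_def)
      finally have dist: "dist (nf f) (nf g) \<le> \<epsilon> * (\<rho> / D)" .
      have words: "f \<in> word_map \<phi> ` lists {1..\<kappa>}" "g \<in> word_map \<phi> ` lists {1..\<kappa>}"
        using norm(4)[OF _ _ _ fg(1)] norm(4)[OF _ _ _ fg(2)] by blast+
      then have "affine_bij f" "affine_bij g"
        using word_map_affine_bij[of "{1..\<kappa>}" \<phi>, OF aff] by blast+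
      moreover have "\<rho> / D * r \<le> \<bar>slope g\<bar>"
        using norm(1)[OF _ _ _ fg(2)] by simp
      moreover have "\<bar>slope f / r - slope g / r\<bar> \<le> \<epsilon> * (\<rho> / D)"
        "\<bar>(f 0 - x) / r - (g 0 - x) / r\<bar> \<le> \<epsilon> * (\<rho> / D)"
        using dist_fst_le[of "nf f" "nf g"] dist_snd_le[of "nf f" "nf g"] dist
        by (simp_all add: nf_def dist_real_def)
      ultimately have "\<exists>a b. (\<forall>x. f x = g (a * x + b)) \<and> \<bar>a - 1\<bar> \<le> \<epsilon> \<and> \<bar>b\<bar> \<le> \<epsilon>"
        using r D \<rho> by (intro near_identity_pair[where r = r and c = "\<rho> / D" and x = x]) auto
      with none words \<open>f \<noteq> g\<close> show False by blast
    qed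
    moreover have "y ` N \<subseteq> F" using y by blast
    ultimately show ?thesis
      using F(1) by (metis N_def card_inj_on_le inj_on_finite)
  qed
  then show False
    using not_wsc unfolding uniform_weak_separation_def by blast
qed

theorem theorem5p5:
  fixes \<kappa> :: nat and \<phi> :: "nat \<Rightarrow> real \<Rightarrow> real" and E W :: "real set"
  assumes "similitude_ifs \<kappa> \<phi>"
    and "is_self_similar_set \<kappa> \<phi> E"
    and "moran_base \<kappa> \<phi> W"
    and "E \<subseteq> {0..1}"
    and "furstenberg_homogeneous E"
    and "hausdorff_dim E < 1"
  shows "uniform_weak_separation \<kappa> \<phi> W E"
proof (rule ccontr)
  assume not_wsc: "\<not> uniform_weak_separation \<kappa> \<phi> W E"
  have sim: "affine_bij (\<phi> i)" "\<bar>slope (\<phi> i)\<bar> < 1" if i: "i \<in> {1..\<kappa>}" for i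
  proof -
    obtain r where "0 < r" "r < 1" "\<And>x y. \<bar>\<phi> i x - \<phi> i y\<bar> = r * \<bar>x - y\<bar>"
      using assms(1) i unfolding similitude_ifs_def by blast
    then show "affine_bij (\<phi> i)" "\<bar>slope (\<phi> i)\<bar> < 1"
      using similitude_affine_bij[of r "\<phi> i"] by auto
  qed
  obtain i j p q where ij: "i \<in> {1..\<kappa>}" "j \<in> {1..\<kappa>}" and pq: "\<phi> i p = p" "\<phi> j q = q" "p \<noteq> q"
    using assms(1) unfolding similitude_ifs_def by blast
  have E: "E \<noteq> {}" "compact E" "\<And>i. i \<in> {1..\<kappa>} \<Longrightarrow> \<phi> i ` E \<subseteq> E"
    using assms(2) unfolding is_self_similar_set_def by blast+
  define \<rho> where "\<rho> = Min ((\<lambda>i. \<bar>slope (\<phi> i)\<bar>) ` {1..\<kappa>})"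
  have \<rho>_le: "\<rho> \<le> \<bar>slope (\<phi> i)\<bar>" if "i \<in> {1..\<kappa>}" for i
    unfolding \<rho>_def using that by (intro Min_le) auto
  have \<rho>: "0 < \<rho>"
    unfolding \<rho>_def using ij(1) affine_bij_slope[OF sim(1)] by (subst Min_gr_iff) auto
  have W: "bounded W" "0 < diameter W"
    using assms(3) by (auto simp: moran_base_def)
  have word: "affine_bij f" "f ` E \<subseteq> E" if "f \<in> word_map \<phi> ` lists {1..\<kappa>}" for f
    using that word_map_affine_bij[of "{1..\<kappa>}" \<phi>, OF sim(1)]
      word_map_image_subset[of "{1..\<kappa>}" \<phi> E, OF E(3)] by blast+
  have pairs: "\<exists>f g a b. affine_bij f \<and> f ` E \<subseteq> E \<and> affine_bij g \<and> g ` E \<subseteq> E \<and>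
        f \<noteq> g \<and> (\<forall>x. f x = g (a * x + b)) \<and> \<bar>a - 1\<bar> \<le> \<epsilon> \<and> \<bar>b\<bar> \<le> \<epsilon>" if "0 < \<epsilon>" for \<epsilon>
    using near_identity_pairs_exist[of \<kappa> \<phi> \<rho> W E \<epsilon>, OF sim(1) \<rho> \<rho>_le W not_wsc that] word by metis
  have "nearly_fills 1 E"
    unfolding nearly_fills_def
  proof (intro exI conjI)
    obtain e where "e \<in> E" using E by blast
    then show "dense_up_to (1 * (1 - 0)) E {0..1}"
      using assms(4) by (force simp: dense_up_to_def intro!: bexI[of _ e])
  qed simp
  moreover have "nearly_fills ((1 + \<rho> / 6) / (1 + \<rho> / 3) * \<eta>) E" if "nearly_fills \<eta> E" for \<eta>
    using nearly_fills_improve[of "\<phi> i" p E \<rho> "\<phi> j" q \<eta>, OF sim(1)[OF ij(1)] pq(1) E(3)[OF ij(1)] \<rho>_le[OF ij(1)]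
      sim(2)[OF ij(1)] sim(1)[OF ij(2)] pq(2) E(3)[OF ij(2)] \<rho>_le[OF ij(2)] sim(2)[OF ij(2)] pq(3) \<rho> pairs that] .
  ultimately have "nearly_fills \<epsilon> E" if "0 < \<epsilon>" for \<epsilon>
    using nearly_fills_iterate[of E "(1 + \<rho> / 6) / (1 + \<rho> / 3)" \<epsilon>] \<rho> that by simp
  then have "furstenberg_microset {0..1} E"
    by (rule unit_interval_microset[OF assms(4) E(2)])
  then have "furstenberg_miniset {0..1} E"
    using assms(5) by (simp add: furstenberg_homogeneous_def)
  then obtain l t where l: "1 \<le> l" and sub: "{0..1} \<subseteq> (\<lambda>x. l * x + t) ` E"
    unfolding furstenberg_miniset_def by blast
  have "{- t / l..(1 - t) / l} \<subseteq> E"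
  proof
    fix x assume "x \<in> {- t / l..(1 - t) / l}"
    then have "l * x + t \<in> {0..1}"
      using l by (simp add: field_simps)
    then obtain e where "e \<in> E" "l * x + t = l * e + t"
      using sub by blast
    then show "x \<in> E" using l by simp
  qed
  moreover have "- t / l < (1 - t) / l"
    using l by (intro divide_strict_right_mono) auto
  ultimately have "1 \<le> hausdorff_dim E"
    by (rule interval_imp_hausdorff_dim_ge_1)
  with assms(6) show False by simp
qed

end
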